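(* (Orlicz-Urysohn inequality) Let $K\subset\mathbb{R}^n$ be a convex body with the origin in its interior and let $\phi:(0,\infty)\to(0,\infty)$ be an increasing convex function. Then $$\omega_\phi(K)\geq\omega_\phi(B_K).$$ If $\phi$ is strictly convex, equality holds if and only if $K$ is an origin-symmetric Euclidean ball.
   Context: A convex body is a compact convex subset of $\mathbb{R}^n$ with nonempty interior. $B_2^n$ is the closed unit Euclidean ball, $|\cdot|$ volume, $\omega_n=|B_2^n|$, $\mathrm{vrad}(K)=(|K|/\omega_n)^{1/n}$ and $B_K=\mathrm{vrad}(K)B_2^n$. $h_K(u)=\max_{x\in K}\langle x,u\rangle$ is the support function and $\sigma$ the spherical measure on the unit sphere $S^{n-1}$. The Orlicz $\phi$ mean width of $K$ is $$\omega_\phi(K)=\frac{1}{n\omega_n}\int_{S^{n-1}}\phi\big(h_K(u)\big)\,d\sigma(u).$$ An origin-symmetric Euclidean ball is $rB_2^n$ with $r>0$. *)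

theory Defs
  imports "HOL-Analysis.Analysis"
begin

definition convex_body :: "'a::euclidean_space set \<Rightarrow> bool" where
  "convex_body K \<longleftrightarrow> compact K \<and> convex K \<and> interior K \<noteq> {}"

abbreviation vol :: "'a::euclidean_space set \<Rightarrow> real" where
  "vol \<equiv> measure lebesgue"

definition vrad :: "'a::euclidean_space set \<Rightarrow> real" where
  "vrad K = (vol K / vol (cball 0 1 :: 'a set)) powr (1 / real DIM('a))"

definition vrad_ball :: "'a::euclidean_space set \<Rightarrow> 'a set" where
  "vrad_ball K = (\<lambda>x. vrad K *\<^sub>R x) ` cball 0 1"

text \<open>On compact sets the supremum is a maximum.\<close>

definition support_fun :: "'a::euclidean_space set \<Rightarrow> 'a \<Rightarrow> real" where
  "support_fun K u = (SUP x\<in>K. x \<bullet> u)"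

text \<open>
  The (unnormalised) spherical measure on the unit sphere, given by the usual cone formula:
  the measure of \<open>A\<close> is \<open>n\<close> times the volume of \<open>{t u | 0 < t \<le> 1, u \<in> A}\<close>.
  It is obtained as the push-forward of Lebesgue measure on the punctured unit ball under
  \<open>x \<mapsto> x / |x|\<close>, which is \<^const>\<open>sgn\<close> in a normed space.
\<close>

definition sphere_measure :: "'a::euclidean_space measure" where
  "sphere_measure =
     scale_measure (of_nat DIM('a))
       (distr (restrict_space lborel (cball 0 1 - {0})) (restrict_space borel (sphere 0 1)) sgn)"

definition orlicz_mean_width :: "(real \<Rightarrow> real) \<Rightarrow> 'a::euclidean_space set \<Rightarrow> real" where
  "orlicz_mean_width \<phi> K =
     1 / (real DIM('a) * vol (cball 0 1 :: 'a set)) *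
     (\<integral>u. \<phi> (support_fun K u) \<partial>(sphere_measure :: 'a measure))"

definition strictly_convex_on :: "'a::real_vector set \<Rightarrow> ('a \<Rightarrow> real) \<Rightarrow> bool" where
  "strictly_convex_on S f \<longleftrightarrow> convex S \<and>
     (\<forall>x\<in>S. \<forall>y\<in>S. \<forall>u>0. \<forall>v>0. x \<noteq> y \<longrightarrow> u + v = 1 \<longrightarrow>
        f (u *\<^sub>R x + v *\<^sub>R y) < u * f x + v * f y)"

definition origin_symmetric_ball :: "'a::euclidean_space set \<Rightarrow> bool" where
  "origin_symmetric_ball K \<longleftrightarrow> (\<exists>r>0. K = (\<lambda>x. r *\<^sub>R x) ` cball 0 1)"

text \<open>The following facts confirm the cone formula and the total mass \<open>n \<omega>\<^sub>n\<close>.\<close>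

lemma measurable_sgn_sphere:
  "sgn \<in> measurable (restrict_space lborel (cball 0 1 - {0 :: 'a::euclidean_space}))
           (restrict_space borel (sphere 0 1))"
proof -
  have "(sgn :: 'a \<Rightarrow> 'a) \<in> borel_measurable borel"
    unfolding sgn_div_norm[abs_def] by measurable
  then have "sgn \<in> borel_measurable (restrict_space lborel (cball 0 1 - {0 :: 'a}))"
    by (intro measurable_restrict_space1) simp
  then show ?thesis
    by (intro measurable_restrict_space2) (auto simp: space_restrict_space norm_sgn)
qed

lemma space_sphere_measure: "space sphere_measure = sphere 0 1"
  by (simp add: sphere_measure_def space_scale_measure space_restrict_space)

lemma emeasure_sphere_measure:
  fixes A :: "'a::euclidean_space set"
  assumes "A \<in> sets borel" "A \<subseteq> sphere 0 1"
  shows "emeasure sphere_measure A =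
           of_nat DIM('a) * emeasure lborel {t *\<^sub>R u | t u. 0 < t \<and> t \<le> 1 \<and> u \<in> A}"
proof -
  let ?B = "cball 0 1 - {0 :: 'a}"
  have A: "A \<in> sets (restrict_space borel (sphere 0 1))"
    using assms by (auto simp: sets_restrict_space_iff)
  have "sgn -` A \<inter> ?B = {t *\<^sub>R u | t u. 0 < t \<and> t \<le> 1 \<and> u \<in> A}" (is "_ = ?C")
  proof (intro set_eqI iffI)
    fix x assume x: "x \<in> sgn -` A \<inter> ?B"
    then have "x = norm x *\<^sub>R sgn x" "0 < norm x" "norm x \<le> 1" "sgn x \<in> A"
      by (auto simp: sgn_div_norm)
    then show "x \<in> ?C" by blast
  next
    fix x assume "x \<in> ?C"
    then obtain t u where *: "x = t *\<^sub>R u" "0 < t" "t \<le> 1" "u \<in> A" by blast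
    then have "norm u = 1" using assms by auto
    then show "x \<in> sgn -` A \<inter> ?B"
      using * by (auto simp: sgn_scaleR sgn_div_norm)
  qed
  moreover have "emeasure (restrict_space lborel ?B) (sgn -` A \<inter> ?B)
      = emeasure lborel (sgn -` A \<inter> ?B)"
    by (intro emeasure_restrict_space) auto
  ultimately show ?thesis
    using A by (simp add: sphere_measure_def emeasure_distr[OF measurable_sgn_sphere]
        space_restrict_space)
qed

lemma measure_sphere_measure:
  "measure sphere_measure (sphere 0 1 :: 'a::euclidean_space set)
     = real DIM('a) * vol (cball 0 1 :: 'a set)"
proof -
  have "{t *\<^sub>R u | t u. 0 < t \<and> t \<le> 1 \<and> u \<in> sphere 0 1} = cball 0 1 - {0 :: 'a}"
  proof (intro set_eqI iffI)
    fix x :: 'a assume "x \<in> cball 0 1 - {0}"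
    then have "x = norm x *\<^sub>R sgn x" "0 < norm x" "norm x \<le> 1" "sgn x \<in> sphere 0 1"
      by (auto simp: sgn_div_norm)
    then show "x \<in> {t *\<^sub>R u | t u. 0 < t \<and> t \<le> 1 \<and> u \<in> sphere 0 1}" by blast
  qed auto
  moreover have "emeasure lborel (cball 0 1 - {0 :: 'a}) = emeasure lborel (cball 0 1 :: 'a set)"
    by (subst emeasure_Diff) auto
  ultimately have "emeasure sphere_measure (sphere 0 1 :: 'a set)
      = of_nat DIM('a) * emeasure lborel (cball 0 1 :: 'a set)"
    by (subst emeasure_sphere_measure) auto
  then show ?thesis
    by (simp add: measure_def enn2real_mult)
qed

end

theory Submission
  imports Defs "HOL-Probability.Distribution_Functions"
begin

text \<open>
  Jensen's inequality bounds \<open>\<omega>\<^sub>\<phi>(K)\<close> below by \<open>\<phi>(m)\<close>, where \<open>m\<close> is the mean of \<open>h\<^sub>K\<close>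
  over the sphere, and Urysohn's inequality \<open>m \<ge> vrad K\<close> finishes the estimate because \<open>\<phi>\<close> is
  increasing. For strictly convex \<open>\<phi>\<close>, equality in Jensen alone already makes \<open>h\<^sub>K\<close> constant,
  so the equality case of Urysohn is never needed.

  Urysohn's inequality comes from two bounds on \<open>|B + tK|\<close>, where \<open>B\<close> is the unit ball. By
  Brunn--Minkowski it is at least \<open>|B| (1 + t vrad K)\<^sup>n\<close>. On the other hand, testing a point
  \<open>x = y + tk\<close> against its own direction \<open>u\<close> gives \<open>|x| \<le> 1 + t h\<^sub>K(u)\<close>, so in polar coordinates
  \<open>|B + tK|\<close> is at most \<open>|B|\<close> times the mean of \<open>(1 + t h\<^sub>K)\<^sup>n\<close>. Both bounds agree at \<open>t = 0\<close>, and
  comparing their derivatives there yields the claim.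

  Brunn--Minkowski is proved by the Hadwiger--Ohmann argument: for finite unions of disjoint boxes,
  cut one set by a coordinate hyperplane separating two of its boxes and the other by a parallel
  hyperplane in the same volume ratio, and induct on the number of boxes; single boxes reduce to
  the AM-GM inequality.
\<close>

\<comment> \<open>As a simp rule it would turn the volume of a Borel set into \<open>measure lborel\<close>.\<close>
declare measure_completion [simp del]

section \<open>Volume radius\<close>

lemma vol_unit_cball_pos: "0 < vol (cball 0 1 :: 'a::euclidean_space set)"
  by (simp add: measure_completion)

lemma vol_open_pos:
  fixes A :: "'a::euclidean_space set"
  assumes "open A" "bounded A" "A \<noteq> {}"
  shows "0 < vol A"
proof -
  have "A \<in> lmeasurable" using assms by (simp add: lmeasurable_open)
  then have "vol A \<noteq> 0" using open_not_negligible[OF assms(1,3)] negligible_iff_measure0 by blast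
  then show ?thesis by (simp add: order_less_le)
qed

lemma vol_interior_convex:
  fixes K :: "'a::euclidean_space set"
  assumes "convex K" "bounded K"
  shows "vol (interior K) = vol K"
  by (rule measure_interior[OF assms(2) negligible_convex_frontier[OF assms(1)]])

lemma vol_scaleR_image:
  fixes A :: "'a::euclidean_space set"
  shows "vol ((*\<^sub>R) c ` A) = \<bar>c\<bar> ^ DIM('a) * vol A"
  using measure_lebesgue_affine[of c 0 A] by simp

lemma vrad_eq_root:
  fixes A :: "'a::euclidean_space set"
  shows "vrad A = root DIM('a) (vol A / vol (cball 0 1 :: 'a set))"
  unfolding vrad_def by (rule root_powr_inverse[symmetric]) auto

lemma vrad_nonneg: "0 \<le> vrad A"
  by (simp add: vrad_def)

lemma vol_eq_vrad_power:
  fixes A :: "'a::euclidean_space set"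
  shows "vol A = vol (cball 0 1 :: 'a set) * vrad A ^ DIM('a)"
  using vol_unit_cball_pos[where 'a='a] by (simp add: vrad_eq_root)

lemma vrad_le_iff:
  fixes A B :: "'a::euclidean_space set"
  shows "vrad A \<le> vrad B \<longleftrightarrow> vol A \<le> vol B"
  using vol_unit_cball_pos[where 'a='a] by (simp add: vrad_eq_root divide_le_cancel)

lemma vrad_mono:
  fixes A B :: "'a::euclidean_space set"
  assumes "A \<subseteq> B" "open A" "open B" "bounded B"
  shows "vrad A \<le> vrad B"
  unfolding vrad_le_iff using assms
  by (intro measure_mono_fmeasurable) (auto intro: lmeasurable_open)

lemma vrad_pos_iff:
  fixes A :: "'a::euclidean_space set"
  shows "0 < vrad A \<longleftrightarrow> 0 < vol A"
  using vol_unit_cball_pos[where 'a='a] by (simp add: vrad_eq_root zero_less_divide_iff)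

lemma vrad_scaleR_image:
  fixes A :: "'a::euclidean_space set"
  shows "vrad ((*\<^sub>R) c ` A) = \<bar>c\<bar> * vrad A"
  by (simp add: vrad_eq_root vol_scaleR_image real_root_mult real_root_power_cancel
      flip: times_divide_eq_right)

lemma vrad_interior_convex: "convex K \<Longrightarrow> bounded K \<Longrightarrow> vrad (interior K) = vrad K"
  by (simp add: vrad_def vol_interior_convex)

lemma scaleR_image_unit_cball:
  assumes "0 \<le> r"
  shows "(*\<^sub>R) r ` cball 0 1 = cball (0 :: 'a::euclidean_space) r"
proof (cases "r = 0")
  case False
  then show ?thesis using assms cball_scale[of r "0 :: 'a" 1] by simp
qed (simp add: image_constant_conv)

lemma vrad_cball:
  assumes "0 \<le> r"
  shows "vrad (cball 0 r :: 'a::euclidean_space set) = r"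
proof -
  have "vrad (cball 0 1 :: 'a set) = 1"
    using vol_unit_cball_pos[where 'a='a] by (simp add: vrad_eq_root)
  then show ?thesis
    using assms vrad_scaleR_image[of r "cball 0 1 :: 'a set"] by (simp add: scaleR_image_unit_cball)
qed

lemma vrad_ball: "vrad (ball 0 1 :: 'a::euclidean_space set) = 1"
  using vrad_interior_convex[of "cball 0 1 :: 'a set"] by (simp add: vrad_cball)

section \<open>The Brunn--Minkowski inequality\<close>

lemma open_set_plus: "open A \<Longrightarrow> open (A + B)" for A B :: "'a::real_normed_vector set"
  using open_sums[of A B] by (simp add: set_plus_def Bex_def UNION_eq)

lemma bounded_set_plus: "bounded A \<Longrightarrow> bounded B \<Longrightarrow> bounded (A + B)"
  for A B :: "'a::real_normed_vector set"
  by (simp add: set_plus_image bounded_plus)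

lemma root_prod_add_le:
  fixes p q :: "'b \<Rightarrow> real"
  assumes S: "finite S" "S \<noteq> {}" and p: "\<And>i. i \<in> S \<Longrightarrow> 0 \<le> p i" and q: "\<And>i. i \<in> S \<Longrightarrow> 0 \<le> q i"
  shows "root (card S) (\<Prod>i\<in>S. p i) + root (card S) (\<Prod>i\<in>S. q i)
    \<le> root (card S) (\<Prod>i\<in>S. p i + q i)"
proof (cases "\<exists>i\<in>S. p i + q i = 0")
  case True
  then have "(\<Prod>i\<in>S. p i) = 0" "(\<Prod>i\<in>S. q i) = 0" "(\<Prod>i\<in>S. p i + q i) = 0"
    using S p q by (auto simp: add_nonneg_eq_0_iff)
  then show ?thesis by simp
next
  case False
  let ?n = "card S" and ?R = "root (card S)"
  have n: "0 < ?n" using S by (simp add: card_gt_0_iff)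
  have pq: "0 < p i + q i" if "i \<in> S" for i using p q False that by (simp add: order_less_le)
  have am_gm: "?R (\<Prod>i\<in>S. r i) / ?R (\<Prod>i\<in>S. p i + q i) \<le> (\<Sum>i\<in>S. r i / (p i + q i)) / ?n"
    if r: "\<And>i. i \<in> S \<Longrightarrow> 0 \<le> r i" for r
  proof -
    have nonneg: "0 \<le> r i / (p i + q i)" if "i \<in> S" for i
      using pq[OF that] r[OF that] by simp
    have "?R (\<Prod>i\<in>S. r i) / ?R (\<Prod>i\<in>S. p i + q i) = ?R (\<Prod>i\<in>S. r i / (p i + q i))"
      by (simp add: prod_dividef real_root_divide)
    also have "\<dots> = (\<Prod>i\<in>S. r i / (p i + q i)) powr (1 / ?n)"
      using n nonneg by (intro root_powr_inverse prod_nonneg) auto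
    also have "\<dots> \<le> (\<Sum>i\<in>S. r i / (p i + q i) / ?n)"
      using S nonneg by (rule arith_geom_mean)
    finally show ?thesis by (simp add: sum_divide_distrib)
  qed
  have "(?R (\<Prod>i\<in>S. p i) + ?R (\<Prod>i\<in>S. q i)) / ?R (\<Prod>i\<in>S. p i + q i)
      \<le> ((\<Sum>i\<in>S. p i / (p i + q i)) + (\<Sum>i\<in>S. q i / (p i + q i))) / ?n"
    using am_gm[of p] am_gm[of q] p q by (simp add: add_divide_distrib)
  also have "(\<Sum>i\<in>S. p i / (p i + q i)) + (\<Sum>i\<in>S. q i / (p i + q i)) = (\<Sum>i\<in>S. 1)"
    unfolding sum.distrib[symmetric]
    by (intro sum.cong) (use pq in \<open>force simp flip: add_divide_distrib\<close>)+
  finally show ?thesis using n pq by (simp add: divide_le_eq prod_pos)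
qed

lemma box_add_subset_set_plus:
  fixes a b c d :: "'a::euclidean_space"
  assumes "box a b \<noteq> {}" "box c d \<noteq> {}"
  shows "box (a + c) (b + d) \<subseteq> box a b + box c d"
proof
  fix z assume z: "z \<in> box (a + c) (b + d)"
  have "\<exists>x. max (a \<bullet> i) (z \<bullet> i - d \<bullet> i) < x \<and> x < min (b \<bullet> i) (z \<bullet> i - c \<bullet> i)" if "i \<in> Basis" for i
    using assms z that by (intro dense) (auto simp: box_ne_empty mem_box inner_add_left)
  then obtain x where
    "\<forall>i\<in>Basis. max (a \<bullet> i) (z \<bullet> i - d \<bullet> i) < x \<bullet> i \<and> x \<bullet> i < min (b \<bullet> i) (z \<bullet> i - c \<bullet> i)"
    using choice_Basis_iff[of
        "\<lambda>i x. max (a \<bullet> i) (z \<bullet> i - d \<bullet> i) < x \<and> x < min (b \<bullet> i) (z \<bullet> i - c \<bullet> i)"]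
    by blast
  then have "x \<in> box a b" "z - x \<in> box c d"
    by (auto simp: mem_box inner_diff_left less_diff_eq diff_less_eq add.commute)
  then show "z \<in> box a b + box c d"
    using set_plus_intro[of x _ "z - x"] by simp
qed

lemma brunn_minkowski_box:
  fixes a b c d :: "'a::euclidean_space"
  assumes "box a b \<noteq> {}" "box c d \<noteq> {}"
  shows "vrad (box a b) + vrad (box c d) \<le> vrad (box a b + box c d)"
proof -
  let ?\<omega> = "vol (cball 0 1 :: 'a set)"
  have pos: "0 < (b - a) \<bullet> i" "0 < (d - c) \<bullet> i" if "i \<in> Basis" for i
    using assms that by (auto simp: box_ne_empty inner_diff_left)
  have vrad_box: "vrad (box l u) = root DIM('a) (\<Prod>i\<in>Basis. (u - l) \<bullet> i) / root DIM('a) ?\<omega>"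
    if "\<And>i. i \<in> Basis \<Longrightarrow> 0 < (u - l) \<bullet> i" for l u :: 'a
    using that by (auto simp: vrad_eq_root real_root_divide measure_completion measure_lborel_box_eq
        inner_diff_left less_imp_le)
  have sum: "(b + d - (a + c)) \<bullet> i = (b - a) \<bullet> i + (d - c) \<bullet> i" for i
    by (simp add: algebra_simps)
  have "vrad (box a b) + vrad (box c d) \<le> vrad (box (a + c) (b + d))"
    using pos vol_unit_cball_pos[where 'a='a]
      root_prod_add_le[of "Basis :: 'a set" "\<lambda>i. (b - a) \<bullet> i" "\<lambda>i. (d - c) \<bullet> i"]
    by (simp add: vrad_box sum add_pos_pos less_imp_le divide_right_mono flip: add_divide_distrib)
  also have "\<dots> \<le> vrad (box a b + box c d)"
    using box_add_subset_set_plus[OF assms]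
    by (intro vrad_mono) (auto intro: open_set_plus bounded_set_plus)
  finally show ?thesis .
qed

lemma vol_split_hyperplane:
  fixes A :: "'a::euclidean_space set"
  assumes A: "A \<in> lmeasurable" and "v \<noteq> 0"
  shows "vol A = vol (A \<inter> {x. x \<bullet> v < s}) + vol (A \<inter> {x. s < x \<bullet> v})"
proof -
  let ?L = "A \<inter> {x. x \<bullet> v < s}" and ?U = "A \<inter> {x. s < x \<bullet> v}"
  have "negligible {x. x \<bullet> v = s}"
    using negligible_hyperplane[of v s] \<open>v \<noteq> 0\<close> by (simp add: inner_commute)
  then have "vol A = vol (?L \<union> ?U)"
    by (intro measure_negligible_symdiff[OF A, symmetric]) (auto elim: negligible_subset)
  also have "\<dots> = vol ?L + vol ?U"
    using A by (intro measure_Un2[THEN trans] fmeasurable_Int_fmeasurable)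
      (auto simp: open_halfspace_component_lt open_halfspace_component_gt
        intro!: arg_cong[where f=vol])
  finally show ?thesis .
qed

lemma (in finite_borel_measure) exists_cdf_eq:
  assumes no_atoms: "\<And>x. measure M {x} = 0" and c: "0 < c" "c < measure M (space M)"
  shows "\<exists>x. cdf M x = c"
proof -
  obtain b where b: "c < cdf M b"
    using order_tendstoD(1)[OF cdf_lim_at_top c(2)] by (metis eventually_at_top_linorder order_refl)
  obtain a where a: "cdf M a < c"
    using order_tendstoD(2)[OF cdf_lim_at_bot c(1)] by (metis eventually_at_bot_linorder order_refl)
  have "a \<le> b" using a b cdf_nondecreasing[of b a] by linarith
  then show ?thesis
    using IVT[of "cdf M" a c b] a b no_atoms by (auto simp: isCont_cdf)
qed

lemma exists_proportional_halfspace: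
  fixes A :: "'a::euclidean_space set"
  assumes A: "A \<in> lmeasurable" and "v \<noteq> 0" and r: "0 < r" "r < 1"
  shows "\<exists>s. vol (A \<inter> {x. x \<bullet> v < s}) = r * vol A"
proof (cases "vol A = 0")
  case True
  have "vol (A \<inter> {x. x \<bullet> v < 0}) \<le> vol A"
    using A by (intro measure_mono_fmeasurable) (auto simp: open_halfspace_component_lt)
  then show ?thesis using True by (intro exI[of _ 0]) (simp add: measure_le_0_iff)
next
  case False
  define M where "M = distr (restrict_space lebesgue A) borel (\<lambda>x. x \<bullet> v)"
  have meas: "(\<lambda>x. x \<bullet> v) \<in> borel_measurable (restrict_space lebesgue A)"
    by (intro measurable_restrict_space1 measurable_completion) simp
  have M: "measure M S = vol (A \<inter> {x. x \<bullet> v \<in> S})" if "S \<in> sets borel" for S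
  proof -
    have "measure M S = measure (restrict_space lebesgue A) (A \<inter> {x. x \<bullet> v \<in> S})"
      using meas that by (simp add: M_def measure_distr space_restrict_space vimage_def Int_commute)
    then show ?thesis using A by (simp add: measure_restrict_space)
  qed
  have "finite_measure (restrict_space lebesgue A)"
    using A by (intro finite_measureI)
      (auto simp: emeasure_restrict_space space_restrict_space fmeasurable_def)
  then interpret finite_borel_measure M
    unfolding M_def finite_borel_measure_def finite_borel_measure_axioms_def
    using meas by (simp add: finite_measure.finite_measure_distr)
  have no_atoms: "measure M {s} = 0" for s
    using negligible_hyperplane[of v s] \<open>v \<noteq> 0\<close>
    by (auto simp: M inner_commute intro!: negligible_imp_measure0 elim: negligible_subset)
  have "measure M (space M) = vol A" using M[of UNIV] by (simp add: M_def)
  then obtain s where s: "cdf M s = r * vol A"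
    using exists_cdf_eq[OF no_atoms, of "r * vol A"] r False by (auto simp: order_less_le)
  have "measure M ({..<s} \<union> {s}) = measure M {..<s} + measure M {s}"
    by (rule finite_measure_Union) (auto simp: sets_M)
  then have "cdf M s = vol (A \<inter> {x. x \<bullet> v < s})"
    unfolding cdf_def ivl_disj_un_singleton using no_atoms[of s] M[of "{..<s}"] by simp
  with s show ?thesis by metis
qed

lemma vol_ge_of_portions:
  fixes A B A' B' S :: "'a::euclidean_space set"
  assumes le: "vrad A' + vrad B' \<le> vrad (A' + B')"
    and vol: "vol A' = r * vol A" "vol B' = r * vol B" and "0 \<le> r"
    and S: "open A'" "A' + B' \<subseteq> S" "S \<in> lmeasurable"
  shows "r * (vol (cball 0 1 :: 'a set) * (vrad A + vrad B) ^ DIM('a)) \<le> vol S"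
proof -
  let ?\<omega> = "vol (cball 0 1 :: 'a set)"
  have "vrad A' + vrad B' = root DIM('a) r * (vrad A + vrad B)"
    by (simp add: vrad_eq_root vol real_root_mult distrib_left flip: times_divide_eq_right)
  then have "r * (?\<omega> * (vrad A + vrad B) ^ DIM('a)) = ?\<omega> * (vrad A' + vrad B') ^ DIM('a)"
    using \<open>0 \<le> r\<close> by (simp add: power_mult_distrib)
  also have "\<dots> \<le> ?\<omega> * vrad (A' + B') ^ DIM('a)"
    using le by (intro mult_left_mono power_mono) (auto simp: vrad_nonneg)
  also have "\<dots> = vol (A' + B')" by (rule vol_eq_vrad_power[symmetric])
  also have "\<dots> \<le> vol S"
    using S by (intro measure_mono_fmeasurable) (auto simp: open_set_plus)
  finally show ?thesis .
qed

lemma brunn_minkowski_bisect: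
  fixes A B :: "'a::euclidean_space set"
  assumes A: "open A" "bounded A" and B: "open B" "bounded B" and "v \<noteq> 0" and r: "0 < r" "r < 1"
    and volA: "vol (A \<inter> {x. x \<bullet> v < s}) = r * vol A"
    and volB: "vol (B \<inter> {x. x \<bullet> v < t}) = r * vol B"
    and lower: "vrad (A \<inter> {x. x \<bullet> v < s}) + vrad (B \<inter> {x. x \<bullet> v < t})
      \<le> vrad ((A \<inter> {x. x \<bullet> v < s}) + (B \<inter> {x. x \<bullet> v < t}))"
    and upper: "vrad (A \<inter> {x. s < x \<bullet> v}) + vrad (B \<inter> {x. t < x \<bullet> v})
      \<le> vrad ((A \<inter> {x. s < x \<bullet> v}) + (B \<inter> {x. t < x \<bullet> v}))"
  shows "vrad A + vrad B \<le> vrad (A + B)"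
proof -
  let ?V = "vol (cball 0 1 :: 'a set) * (vrad A + vrad B) ^ DIM('a)"
  note halfspaces = open_halfspace_component_lt open_halfspace_component_gt
  have lm: "A \<in> lmeasurable" "B \<in> lmeasurable" "A + B \<in> lmeasurable"
    using A B by (auto intro: lmeasurable_open open_set_plus bounded_set_plus)
  have "r * ?V \<le> vol ((A + B) \<inter> {x. x \<bullet> v < s + t})"
    using A r lm(3)
    by (intro vol_ge_of_portions[OF lower volA volB] fmeasurable_Int_fmeasurable)
      (auto simp: inner_add_left halfspaces open_Int elim!: set_plus_elim)
  moreover have "(1 - r) * ?V \<le> vol ((A + B) \<inter> {x. s + t < x \<bullet> v})"
  proof -
    have "vol (A \<inter> {x. s < x \<bullet> v}) = (1 - r) * vol A"
      using vol_split_hyperplane[OF lm(1) \<open>v \<noteq> 0\<close>, of s] volA by (simp add: left_diff_distrib)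
    moreover have "vol (B \<inter> {x. t < x \<bullet> v}) = (1 - r) * vol B"
      using vol_split_hyperplane[OF lm(2) \<open>v \<noteq> 0\<close>, of t] volB by (simp add: left_diff_distrib)
    ultimately show ?thesis
      using A r lm(3)
      by (intro vol_ge_of_portions[OF upper] fmeasurable_Int_fmeasurable)
        (auto simp: inner_add_left halfspaces open_Int elim!: set_plus_elim)
  qed
  ultimately have "?V \<le> vol (A + B)"
    using vol_split_hyperplane[OF lm(3) \<open>v \<noteq> 0\<close>, of "s + t"] by (simp add: left_diff_distrib)
  then have "(vrad A + vrad B) ^ DIM('a) \<le> vrad (A + B) ^ DIM('a)"
    unfolding vol_eq_vrad_power[of "A + B"] using vol_unit_cball_pos[where 'a='a] by simp
  then show ?thesis by (rule power_mono_iff[THEN iffD1, rotated -1]) (simp_all add: vrad_nonneg)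
qed

definition box_family :: "'a::euclidean_space set set \<Rightarrow> bool" where
  "box_family D \<longleftrightarrow> finite D \<and> disjoint D \<and> (\<forall>d\<in>D. d \<noteq> {} \<and> (\<exists>a b. d = box a b))"

definition trim :: "'a set \<Rightarrow> 'a set set \<Rightarrow> 'a set set" where
  "trim H D = (\<lambda>d. d \<inter> H) ` D - {{}}"

lemma Union_trim: "\<Union>(trim H D) = \<Union>D \<inter> H"
  by (auto simp: trim_def)

lemma card_trim_le: "finite D \<Longrightarrow> card (trim H D) \<le> card D"
  unfolding trim_def by (meson card_Diff1_le card_image_le dual_order.trans finite_imageI)

lemma card_trim_less:
  assumes "finite D" "d \<in> D" "d \<inter> H = {}"
  shows "card (trim H D) < card D"
proof -
  have "trim H D = trim H (D - {d})" using assms by (auto simp: trim_def)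
  also have "card \<dots> \<le> card (D - {d})" using assms by (intro card_trim_le) auto
  also have "\<dots> < card D" using assms by (intro card_Diff1_less)
  finally show ?thesis .
qed

lemma box_Int_halfspace:
  fixes a b :: "'a::euclidean_space"
  assumes "i \<in> Basis"
  shows "\<exists>c d. box a b \<inter> {x. x \<bullet> i < s} = box c d"
    and "\<exists>c d. box a b \<inter> {x. s < x \<bullet> i} = box c d"
proof -
  have "interior {x. x \<bullet> i \<le> s} = {x. x \<bullet> i < s}" "interior {x. s \<le> x \<bullet> i} = {x. s < x \<bullet> i}"
    using assms interior_halfspace_le[of i s] interior_halfspace_ge[of i s]
    by (auto simp: inner_commute nonzero_Basis)
  then show "\<exists>c d. box a b \<inter> {x. x \<bullet> i < s} = box c d" "\<exists>c d. box a b \<inter> {x. s < x \<bullet> i} = box c d"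
    using interval_split[OF assms, of a b s, THEN arg_cong[of _ _ interior]]
    by (auto simp: interior_cbox)
qed

lemma box_family_trim:
  assumes "box_family D" and H: "\<And>a b. \<exists>c d. box a b \<inter> H = box c d"
  shows "box_family (trim H D)"
proof -
  have D: "finite D" "disjoint D" "\<forall>d\<in>D. \<exists>a b. d = box a b"
    using assms(1) unfolding box_family_def by auto
  have "\<exists>c d. e = box c d" if "e \<in> trim H D" for e
    using that D(3) H unfolding trim_def by fastforce
  moreover have "finite (trim H D)" "{} \<notin> trim H D"
    using D(1) by (auto simp: trim_def)
  moreover have "disjoint (trim H D)"
    using D(2) by (auto simp: trim_def pairwise_def disjnt_def)
  ultimately show ?thesis by (auto simp: box_family_def)
qed

lemma open_Union_box_family: "box_family D \<Longrightarrow> open (\<Union>D)"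
  unfolding box_family_def by (auto intro!: open_Union)

lemma bounded_Union_box_family: "box_family D \<Longrightarrow> bounded (\<Union>D)"
  unfolding box_family_def by (auto intro!: bounded_Union)

lemma vol_box_family_pos: "box_family D \<Longrightarrow> D \<noteq> {} \<Longrightarrow> 0 < vol (\<Union>D)"
  by (intro vol_open_pos open_Union_box_family bounded_Union_box_family) (auto simp: box_family_def)

lemma disjoint_boxes_separated:
  fixes a b c d :: "'a::euclidean_space"
  assumes "box a b \<inter> box c d = {}" "box a b \<noteq> {}" "box c d \<noteq> {}"
  obtains i s where "i \<in> Basis" "box a b \<subseteq> {x. x \<bullet> i < s}" "box c d \<subseteq> {x. s < x \<bullet> i}"
  | i s where "i \<in> Basis" "box c d \<subseteq> {x. x \<bullet> i < s}" "box a b \<subseteq> {x. s < x \<bullet> i}"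
proof -
  obtain i where i: "i \<in> Basis" "b \<bullet> i \<le> c \<bullet> i \<or> d \<bullet> i \<le> a \<bullet> i"
    using assms unfolding disjoint_interval box_ne_empty by (meson leD)
  show thesis
  proof (cases "b \<bullet> i \<le> c \<bullet> i")
    case True
    then show thesis
      using i by (intro that(1)[of i "b \<bullet> i"]) (auto simp: mem_box intro: le_less_trans)
  next
    case False
    then show thesis
      using i by (intro that(2)[of i "d \<bullet> i"]) (auto simp: mem_box intro: le_less_trans)
  qed
qed

lemma box_family_separating_hyperplane:
  fixes D :: "'a::euclidean_space set set"
  assumes D: "box_family D" and "1 < card D"
  obtains i s where "i \<in> Basis"
    "trim {x. x \<bullet> i < s} D \<noteq> {}" "card (trim {x. x \<bullet> i < s} D) < card D"
    "trim {x. s < x \<bullet> i} D \<noteq> {}" "card (trim {x. s < x \<bullet> i} D) < card D"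
proof -
  have fin: "finite D" using D by (simp add: box_family_def)
  obtain p q where pq: "p \<in> D" "q \<in> D" "p \<noteq> q"
    using \<open>1 < card D\<close> by (metis One_nat_def card_le_Suc0_iff_eq fin not_less)
  obtain a b c d where "p = box a b" "q = box c d" using D pq unfolding box_family_def by metis
  moreover have "p \<inter> q = {}" "p \<noteq> {}" "q \<noteq> {}"
    using D pq by (auto simp: box_family_def disjoint_def)
  ultimately obtain i s p' q' where i: "i \<in> Basis" and sep: "p' \<in> D" "q' \<in> D" "p' \<noteq> {}" "q' \<noteq> {}"
      "p' \<subseteq> {x. x \<bullet> i < s}" "q' \<subseteq> {x. s < x \<bullet> i}"
    using pq by (metis disjoint_boxes_separated)
  have "p' \<in> trim {x. x \<bullet> i < s} D" "q' \<in> trim {x. s < x \<bullet> i} D"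
    using sep by (auto simp: trim_def image_iff Int_absorb2 intro!: bexI)
  moreover have "q' \<inter> {x. x \<bullet> i < s} = {}" "p' \<inter> {x. s < x \<bullet> i} = {}" using sep by fastforce+
  ultimately show thesis
    using that[OF i] card_trim_less[OF fin] sep by (metis empty_iff)
qed

lemma box_family_proportional_halfspace:
  fixes E :: "'a::euclidean_space set set"
  assumes E: "box_family E" "E \<noteq> {}" and "v \<noteq> 0" and r: "0 < r" "r < 1"
  obtains t where "vol (\<Union>E \<inter> {x. x \<bullet> v < t}) = r * vol (\<Union>E)"
    "trim {x. x \<bullet> v < t} E \<noteq> {}" "trim {x. t < x \<bullet> v} E \<noteq> {}"
proof -
  have E_lm: "\<Union>E \<in> lmeasurable"
    using open_Union_box_family[OF E(1)] bounded_Union_box_family[OF E(1)]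
    by (intro lmeasurable_open)
  obtain t where lower: "vol (\<Union>E \<inter> {x. x \<bullet> v < t}) = r * vol (\<Union>E)"
    using exists_proportional_halfspace[OF E_lm \<open>v \<noteq> 0\<close> r] by blast
  then have "vol (\<Union>E \<inter> {x. t < x \<bullet> v}) = (1 - r) * vol (\<Union>E)"
    using vol_split_hyperplane[OF E_lm \<open>v \<noteq> 0\<close>, of t] by (simp add: left_diff_distrib)
  with lower have "0 < vol (\<Union>E \<inter> {x. x \<bullet> v < t})" "0 < vol (\<Union>E \<inter> {x. t < x \<bullet> v})"
    using r vol_box_family_pos[OF E] by simp_all
  then have "trim {x. x \<bullet> v < t} E \<noteq> {}" "trim {x. t < x \<bullet> v} E \<noteq> {}"
    by (metis Union_empty Union_trim less_irrefl measure_empty)+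
  with that lower show thesis by blast
qed

lemma brunn_minkowski_box_family_step:
  fixes D E :: "'a::euclidean_space set set"
  assumes D: "box_family D" and E: "box_family E" "E \<noteq> {}" and two: "1 < card D"
    and IH: "\<And>D' E' :: 'a set set. \<lbrakk>box_family D'; box_family E'; D' \<noteq> {}; E' \<noteq> {};
      card D' + card E' < card D + card E\<rbrakk> \<Longrightarrow> vrad (\<Union>D') + vrad (\<Union>E') \<le> vrad (\<Union>D' + \<Union>E')"
  shows "vrad (\<Union>D) + vrad (\<Union>E) \<le> vrad (\<Union>D + \<Union>E)"
proof -
  obtain i s where i: "i \<in> Basis"
    and lower: "trim {x. x \<bullet> i < s} D \<noteq> {}" "card (trim {x. x \<bullet> i < s} D) < card D"
    and upper: "trim {x. s < x \<bullet> i} D \<noteq> {}" "card (trim {x. s < x \<bullet> i} D) < card D"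
    using box_family_separating_hyperplane[OF D two] .
  have "i \<noteq> 0" using i by (rule nonzero_Basis)
  have trim: "box_family (trim {x. x \<bullet> i < c} F)" "box_family (trim {x. c < x \<bullet> i} F)"
    if "box_family F" for F c
    by (intro box_family_trim that box_Int_halfspace i)+
  note openD = open_Union_box_family[OF D] bounded_Union_box_family[OF D]
  note openE = open_Union_box_family[OF E(1)] bounded_Union_box_family[OF E(1)]
  define r where "r = vol (\<Union>D \<inter> {x. x \<bullet> i < s}) / vol (\<Union>D)"
  have "0 < vol (\<Union>D \<inter> {x. x \<bullet> i < s})" "0 < vol (\<Union>D \<inter> {x. s < x \<bullet> i})"
    using vol_box_family_pos[OF trim(1)[OF D] lower(1)]
      vol_box_family_pos[OF trim(2)[OF D] upper(1)]
    by (simp_all add: Union_trim)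
  moreover have "vol (\<Union>D) = vol (\<Union>D \<inter> {x. x \<bullet> i < s}) + vol (\<Union>D \<inter> {x. s < x \<bullet> i})"
    using openD by (intro vol_split_hyperplane \<open>i \<noteq> 0\<close> lmeasurable_open)
  ultimately have r: "0 < r" "r < 1" and volD: "vol (\<Union>D \<inter> {x. x \<bullet> i < s}) = r * vol (\<Union>D)"
    by (auto simp: r_def)
  obtain t where volE: "vol (\<Union>E \<inter> {x. x \<bullet> i < t}) = r * vol (\<Union>E)"
    and trimE: "trim {x. x \<bullet> i < t} E \<noteq> {}" "trim {x. t < x \<bullet> i} E \<noteq> {}"
    using box_family_proportional_halfspace[OF E \<open>i \<noteq> 0\<close> r] .
  have "card (trim {x. x \<bullet> i < t} E) \<le> card E" "card (trim {x. t < x \<bullet> i} E) \<le> card E"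
    using E(1) by (simp_all add: box_family_def card_trim_le)
  then show ?thesis
    using D E lower upper trimE
    by (intro brunn_minkowski_bisect[OF openD openE \<open>i \<noteq> 0\<close> r volD volE])
      (auto simp flip: Union_trim intro!: IH trim)
qed

lemma brunn_minkowski_box_family:
  fixes D E :: "'a::euclidean_space set set"
  assumes "box_family D" "box_family E" "D \<noteq> {}" "E \<noteq> {}"
  shows "vrad (\<Union>D) + vrad (\<Union>E) \<le> vrad (\<Union>D + \<Union>E)"
  using assms
proof (induction "card D + card E" arbitrary: D E rule: less_induct)
  case less
  have "finite D" "finite E" using less.prems by (auto simp: box_family_def)
  then have "1 \<le> card D" "1 \<le> card E" using less.prems by (auto simp: Suc_le_eq card_gt_0_iff)
  then consider (splitD) "1 < card D" | (splitE) "1 < card E" | (boxes) "card D = 1" "card E = 1"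
    by linarith
  then show ?case
  proof cases
    case splitD
    then show ?thesis
      by (rule brunn_minkowski_box_family_step[OF less.prems(1,2,4) _ less.hyps])
  next
    case splitE
    have "vrad (\<Union>E) + vrad (\<Union>D) \<le> vrad (\<Union>E + \<Union>D)"
      by (rule brunn_minkowski_box_family_step[OF less.prems(2,1,3) splitE less.hyps])
        (simp_all add: add.commute)
    then show ?thesis by (simp add: add.commute)
  next
    case boxes
    then obtain p q where "D = {p}" "E = {q}" by (meson card_1_singletonE)
    then show ?thesis using less.prems by (auto simp: box_family_def intro: brunn_minkowski_box)
  qed
qed

lemma division_interiors_box_family:
  fixes S :: "'a::euclidean_space set"
  assumes p: "p division_of S"
  shows "box_family (interior ` p - {{}})" and "vol (\<Union>(interior ` p - {{}})) = vol S"
proof -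
  have "\<exists>a b. interior K = box a b" if "K \<in> p" for K
    using division_ofD(4)[OF p that] interior_cbox by metis
  moreover have "disjoint (interior ` p - {{}})"
    using division_ofD(5)[OF p] by (intro disjointI) blast
  ultimately show "box_family (interior ` p - {{}})"
    using division_of_finite[OF p] by (auto simp: box_family_def)
  have "S - \<Union>(interior ` p) \<subseteq> (\<Union>k\<in>p. frontier k)"
    using division_ofD(6)[OF p] closure_subset by (fastforce simp: frontier_def)
  moreover have "negligible (\<Union>k\<in>p. frontier k)"
    using division_ofD(1)[OF p] by (intro negligible_Union)
      (auto dest!: division_ofD(4)[OF p] intro: negligible_convex_frontier)
  moreover have "\<Union>(interior ` p) \<subseteq> S" using division_ofD(6)[OF p] interior_subset by blast
  moreover have "S \<in> lmeasurable"
    using division_of_finite[OF p] division_ofD(4,6)[OF p] by (auto intro!: fmeasurable.finite_Union)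
  ultimately have "vol (\<Union>(interior ` p)) = vol S"
    by (intro measure_negligible_symdiff) (auto elim: negligible_subset)
  moreover have "\<Union>(interior ` p - {{}}) = \<Union>(interior ` p)" by auto
  ultimately show "vol (\<Union>(interior ` p - {{}})) = vol S" by simp
qed

lemma box_family_inner_approx:
  fixes A :: "'a::euclidean_space set"
  assumes A: "open A" "bounded A" and c: "0 \<le> c" "c < vol A"
  obtains D where "box_family D" "D \<noteq> {}" "\<Union>D \<subseteq> A" "c < vol (\<Union>D)"
proof -
  obtain \<D> where \<D>: "countable \<D>" "\<D> \<subseteq> Pow A" "\<And>X. X \<in> \<D> \<Longrightarrow> \<exists>a b. X = cbox a b" "\<Union>\<D> = A"
    using open_countable_Union_open_cbox[OF A(1)] by metis
  have lm: "d \<in> lmeasurable" if "d \<in> \<D>" for d using \<D>(3)[OF that] by auto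
  obtain \<F> where \<F>: "\<F> \<subseteq> \<D>" "finite \<F>" "vol (\<Union>\<D>) - (vol A - c) < vol (\<Union>\<F>)"
  proof (rule measure_countable_Union_approachable[OF \<D>(1) _ lm])
    fix \<F> assume "\<F> \<subseteq> \<D>" "finite \<F>"
    then have "\<Union>\<F> \<in> lmeasurable" "\<Union>\<F> \<subseteq> A"
      using lm \<D>(2) by (auto intro: fmeasurable.finite_Union)
    then show "vol (\<Union>\<F>) \<le> vol A"
      using A by (intro measure_mono_fmeasurable) (auto intro: lmeasurable_open)
  qed (use c in auto)
  obtain p where p: "p division_of \<Union>\<F>"
    using elementary_unions_intervals[OF \<F>(2)] \<F>(1) \<D>(3) by (metis subsetD)
  let ?D = "interior ` p - {{}}"
  have "c < vol (\<Union>?D)"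
    using \<F>(3) \<D>(4) division_interiors_box_family(2)[OF p] by simp
  moreover from this have "?D \<noteq> {}" using c by (metis Union_empty measure_empty not_less)
  moreover have "\<Union>?D \<subseteq> A"
    using \<F>(1) \<D>(2) division_ofD(2)[OF p] interior_subset by blast
  ultimately show ?thesis using that division_interiors_box_family(1)[OF p] by blast
qed

theorem brunn_minkowski:
  fixes A B :: "'a::euclidean_space set"
  assumes A: "open A" "bounded A" "A \<noteq> {}" and B: "open B" "bounded B" "B \<noteq> {}"
  shows "vrad A + vrad B \<le> vrad (A + B)"
proof (rule field_le_mult_one_interval)
  fix q :: real assume q: "0 < q" "q < 1"
  have approx: "\<exists>D. box_family D \<and> D \<noteq> {} \<and> \<Union>D \<subseteq> S \<and> q * vrad S \<le> vrad (\<Union>D)"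
    if S: "open S" "bounded S" "S \<noteq> {}" for S :: "'a set"
  proof -
    have "q * vrad S = vrad ((*\<^sub>R) q ` S)" using q by (simp add: vrad_scaleR_image)
    moreover have "vol ((*\<^sub>R) q ` S) < vol S"
      using q vol_open_pos[OF S] by (simp add: vol_scaleR_image power_less_one_iff)
    then obtain D where "box_family D" "D \<noteq> {}" "\<Union>D \<subseteq> S" "vol ((*\<^sub>R) q ` S) < vol (\<Union>D)"
      using box_family_inner_approx[OF S(1,2), of "vol ((*\<^sub>R) q ` S)"] by auto
    ultimately show ?thesis by (auto simp: vrad_le_iff)
  qed
  obtain D where D: "box_family D" "D \<noteq> {}" "\<Union>D \<subseteq> A" "q * vrad A \<le> vrad (\<Union>D)"
    using approx[OF A] by blast
  obtain E where E: "box_family E" "E \<noteq> {}" "\<Union>E \<subseteq> B" "q * vrad B \<le> vrad (\<Union>E)"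
    using approx[OF B] by blast
  have "q * (vrad A + vrad B) \<le> vrad (\<Union>D) + vrad (\<Union>E)" using D E by (simp add: distrib_left)
  also have "\<dots> \<le> vrad (\<Union>D + \<Union>E)" by (rule brunn_minkowski_box_family[OF D(1) E(1) D(2) E(2)])
  also have "\<dots> \<le> vrad (A + B)"
    using A B D E by (intro vrad_mono set_plus_mono2)
      (auto intro: open_set_plus bounded_set_plus open_Union_box_family)
  finally show "q * (vrad A + vrad B) \<le> vrad (A + B)" .
qed

section \<open>The uniform distribution on the sphere\<close>

definition sphere_prob :: "'a::euclidean_space measure" where
  "sphere_prob =
     density sphere_measure (\<lambda>_. ennreal (1 / (real DIM('a) * vol (cball 0 1 :: 'a set))))"

lemma space_sphere_prob [simp]: "space sphere_prob = sphere 0 1"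
  by (simp add: sphere_prob_def space_sphere_measure)

lemma sets_sphere_prob [simp, measurable_cong]:
  "sets sphere_prob = sets (restrict_space borel (sphere 0 1))"
  by (simp add: sphere_prob_def sphere_measure_def)

lemma prob_space_sphere_prob: "prob_space (sphere_prob :: 'a::euclidean_space measure)"
proof
  let ?N = "real DIM('a) * vol (cball 0 1 :: 'a set)"
  have N: "0 < ?N" using vol_unit_cball_pos[where 'a='a] by simp
  then have "emeasure sphere_measure (sphere 0 1 :: 'a set) = ennreal ?N"
    using measure_sphere_measure[where 'a='a]
    by (metis emeasure_eq_ennreal_measure less_irrefl measure_def enn2real_top)
  moreover have "sphere 0 1 \<in> sets (sphere_measure :: 'a measure)"
    by (metis sets.top space_sphere_measure)
  ultimately show "emeasure (sphere_prob :: 'a measure) (space sphere_prob) = 1"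
    using N vol_unit_cball_pos[where 'a='a]
    by (simp add: sphere_prob_def space_sphere_measure emeasure_density_const flip: ennreal_mult)
qed

interpretation sphere_prob: prob_space "sphere_prob :: 'a::euclidean_space measure"
  by (rule prob_space_sphere_prob)

lemma prob_unit_sphere [simp]: "measure sphere_prob (sphere 0 1 :: 'a::euclidean_space set) = 1"
  using sphere_prob.prob_space[where 'a='a] by simp

lemma borel_measurable_sphere_prob:
  fixes f :: "'a::euclidean_space \<Rightarrow> real"
  assumes "continuous_on (sphere 0 1) f"
  shows "f \<in> borel_measurable sphere_prob"
  using borel_measurable_continuous_on_restrict[OF assms]
    measurable_cong_sets[OF sets_sphere_prob refl] by blast

lemma integrable_sphere_prob:
  fixes f :: "'a::euclidean_space \<Rightarrow> real"
  assumes f: "continuous_on (sphere 0 1) f"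
  shows "integrable sphere_prob f"
proof -
  have "bounded (f ` sphere 0 1)"
    by (intro compact_imp_bounded compact_continuous_image f compact_sphere)
  then obtain B where "\<forall>y\<in>f ` sphere 0 1. norm y \<le> B" unfolding bounded_iff by blast
  then show ?thesis
    using borel_measurable_sphere_prob[OF f]
    by (intro sphere_prob.integrable_const_bound[of _ B]) auto
qed

lemma orlicz_mean_width_eq_expectation:
  fixes K :: "'a::euclidean_space set"
  assumes "continuous_on (sphere 0 1) (\<lambda>u. \<phi> (support_fun K u))"
  shows "orlicz_mean_width \<phi> K = sphere_prob.expectation (\<lambda>u. \<phi> (support_fun K u))"
  using borel_measurable_sphere_prob[OF assms] vol_unit_cball_pos[where 'a='a]
  by (simp add: orlicz_mean_width_def sphere_prob_def integral_density)

\<comment> \<open>Only the values of \<open>f\<close> on the unit sphere matter, hence \<open>x \<noteq> 0\<close>; the strict inequality makes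
  \<open>radial_body\<close> commute with suprema.\<close>
definition radial_body :: "('a::euclidean_space \<Rightarrow> ennreal) \<Rightarrow> 'a set" where
  "radial_body f = {x. x \<noteq> 0 \<and> ennreal (norm x) < f (sgn x)}"

lemma sets_radial_body:
  fixes f :: "'a::euclidean_space \<Rightarrow> ennreal"
  assumes [measurable]: "f \<in> borel_measurable sphere_prob"
  shows "radial_body f \<in> sets borel"
proof -
  let ?R = "restrict_space borel (- {0 :: 'a})"
  have "sgn \<in> borel_measurable (borel :: 'a measure)"
    unfolding sgn_div_norm[abs_def] by measurable
  then have [measurable]: "sgn \<in> ?R \<rightarrow>\<^sub>M (sphere_prob :: 'a measure)"
    unfolding measurable_cong_sets[OF refl sets_sphere_prob]
    by (intro measurable_restrict_space2 measurable_restrict_space1)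
      (auto simp: space_restrict_space norm_sgn)
  have [measurable]: "norm \<in> borel_measurable ?R" by (intro measurable_restrict_space1) simp
  have "{x \<in> space ?R. ennreal (norm x) < f (sgn x)} \<in> sets ?R" by measurable
  moreover have "{x \<in> space ?R. ennreal (norm x) < f (sgn x)} = radial_body f"
    by (auto simp: radial_body_def space_restrict_space)
  ultimately show ?thesis by (simp add: sets_restrict_space_iff)
qed

lemma radial_body_indicator: "radial_body (indicator A) = {x. x \<noteq> 0 \<and> norm x < 1 \<and> sgn x \<in> A}"
  by (auto simp: radial_body_def ennreal_less_one_iff split: split_indicator)

lemma unit_cone_eq_radial_body:
  assumes "A \<subseteq> sphere 0 1"
  shows "{t *\<^sub>R u | t u. 0 < t \<and> t \<le> 1 \<and> u \<in> A} = radial_body (indicator A) \<union> A" (is "?C = _")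
proof (intro set_eqI iffI)
  fix x assume "x \<in> radial_body (indicator A) \<union> A"
  then have "x = norm x *\<^sub>R sgn x" "0 < norm x" "norm x \<le> 1" "sgn x \<in> A"
    using assms by (auto simp: radial_body_indicator sgn_div_norm)
  then show "x \<in> ?C" by blast
next
  fix x assume "x \<in> ?C"
  then obtain t u where x: "x = t *\<^sub>R u" "0 < t" "t \<le> 1" "u \<in> A" by blast
  then have "norm u = 1" using assms by auto
  then show "x \<in> radial_body (indicator A) \<union> A"
    using x by (cases "t = 1") (auto simp: radial_body_indicator sgn_scaleR sgn_div_norm)
qed

lemma emeasure_radial_body_indicator:
  fixes A :: "'a::euclidean_space set"
  assumes A: "A \<in> sets sphere_prob"
  shows "emeasure lborel (radial_body (indicator A))
    = emeasure lborel (cball 0 1 :: 'a set) * emeasure sphere_prob A"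
proof -
  let ?\<omega> = "vol (cball 0 1 :: 'a set)" and ?C = "{t *\<^sub>R u | t u. 0 < t \<and> t \<le> 1 \<and> u \<in> A}"
  have borel: "A \<in> sets borel" and sub: "A \<subseteq> sphere 0 1"
    using A by (auto simp: sets_restrict_space_iff)
  have "A \<in> null_sets lborel"
    using borel negligible_subset[OF negligible_sphere sub]
    by (simp add: negligible_iff_null_sets null_sets_completion_iff)
  moreover have "radial_body (indicator A) \<in> sets lborel"
    using sets_radial_body[of "indicator A"] A by simp
  ultimately have "emeasure lborel ?C = emeasure lborel (radial_body (indicator A))"
    by (simp add: unit_cone_eq_radial_body[OF sub] emeasure_Un_null_set)
  moreover have "emeasure sphere_prob A
      = ennreal (1 / (DIM('a) * ?\<omega>)) * (of_nat DIM('a) * emeasure lborel ?C)"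
    using A emeasure_sphere_measure[OF borel sub]
    by (simp add: sphere_prob_def emeasure_density_const)
  moreover have "emeasure lborel (cball 0 1 :: 'a set) = ennreal ?\<omega>"
    using emeasure_eq_measure2[OF lmeasurable_cball[of "0 :: 'a" 1]] by simp
  moreover have "ennreal ?\<omega> * (ennreal (1 / (DIM('a) * ?\<omega>)) * of_nat DIM('a)) = 1"
    using vol_unit_cball_pos[where 'a='a]
    by (simp add: ennreal_of_nat_eq_real_of_nat flip: ennreal_mult)
  ultimately show ?thesis by (simp flip: mult.assoc)
qed

lemma radial_body_scale:
  fixes f :: "'a::euclidean_space \<Rightarrow> ennreal"
  assumes "0 < c"
  shows "radial_body (\<lambda>u. ennreal c * f u) = (*\<^sub>R) c ` radial_body f"
proof -
  have less_iff: "ennreal (norm x) < f (sgn x) \<longleftrightarrow> ennreal (c * norm x) < ennreal c * f (sgn x)" for x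
    using assms ennreal_mult_strict_left_mono[of "ennreal (norm x)" "f (sgn x)" "ennreal c"]
      mult_left_mono[of "f (sgn x)" "ennreal (norm x)" "ennreal c"]
    by (auto simp: ennreal_mult not_less[symmetric])
  show ?thesis
  proof (intro set_eqI iffI)
    fix x assume "x \<in> radial_body (\<lambda>u. ennreal c * f u)"
    then have "(1 / c) *\<^sub>R x \<in> radial_body f"
      using assms less_iff[of "(1 / c) *\<^sub>R x"] by (auto simp: radial_body_def sgn_scaleR)
    moreover have "x = c *\<^sub>R ((1 / c) *\<^sub>R x)" using assms by simp
    ultimately show "x \<in> (*\<^sub>R) c ` radial_body f" by blast
  next
    fix x assume "x \<in> (*\<^sub>R) c ` radial_body f"
    then show "x \<in> radial_body (\<lambda>u. ennreal c * f u)"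
      using assms less_iff by (auto simp: radial_body_def sgn_scaleR)
  qed
qed

lemma tendsto_power_ennreal:
  fixes l :: ennreal
  assumes "(f \<longlongrightarrow> l) F"
  shows "((\<lambda>x. f x ^ n) \<longlongrightarrow> l ^ n) F"
proof (induction n)
  case (Suc n)
  then show ?case
    using assms by (auto intro!: tendsto_mult_ennreal simp: power_eq_top_ennreal)
qed simp

lemma SUP_power_ennreal:
  fixes f :: "nat \<Rightarrow> ennreal"
  assumes "incseq f"
  shows "(SUP i. f i) ^ n = (SUP i. f i ^ n)"
proof (rule LIMSEQ_unique)
  show "(\<lambda>i. f i ^ n) \<longlonglongrightarrow> (SUP i. f i) ^ n"
    by (rule tendsto_power_ennreal[OF LIMSEQ_SUP[OF assms]])
  show "(\<lambda>i. f i ^ n) \<longlonglongrightarrow> (SUP i. f i ^ n)"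
    using assms by (intro LIMSEQ_SUP) (auto simp: incseq_def intro: power_mono)
qed

lemma nn_integral_SUP_power:
  fixes U :: "nat \<Rightarrow> 'a \<Rightarrow> ennreal"
  assumes U: "\<And>i. U i \<in> borel_measurable M" "incseq U"
  shows "(\<integral>\<^sup>+x. (SUP i. U i) x ^ n \<partial>M) = (SUP i. \<integral>\<^sup>+x. U i x ^ n \<partial>M)"
  using U by (subst nn_integral_monotone_convergence_SUP[symmetric])
    (auto simp: SUP_power_ennreal incseq_def le_fun_def image_image intro!: power_mono)

lemma emeasure_radial_body_cmult:
  fixes f :: "'a::euclidean_space \<Rightarrow> ennreal"
  assumes f: "f \<in> borel_measurable sphere_prob" and "0 \<le> c"
  shows "emeasure lborel (radial_body (\<lambda>u. ennreal c * f u))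
    = ennreal (c ^ DIM('a)) * emeasure lborel (radial_body f)"
proof (cases "c = 0")
  case True
  then show ?thesis by (simp add: radial_body_def zero_power)
next
  case False
  have "(\<lambda>u. ennreal c * f u) \<in> borel_measurable sphere_prob" using f by measurable
  then show ?thesis
    using False \<open>0 \<le> c\<close> sets_radial_body[OF f] sets_radial_body[of "\<lambda>u. ennreal c * f u"]
      emeasure_lebesgue_affine[of c 0 "radial_body f"]
    by (simp add: radial_body_scale)
qed

lemma emeasure_radial_body_add:
  fixes f g :: "'a::euclidean_space \<Rightarrow> ennreal"
  assumes f: "f \<in> borel_measurable sphere_prob" and g: "g \<in> borel_measurable sphere_prob"
    and disjoint_supports: "\<And>u. norm u = 1 \<Longrightarrow> f u = 0 \<or> g u = 0"
  shows "emeasure lborel (radial_body (\<lambda>u. f u + g u))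
    = emeasure lborel (radial_body f) + emeasure lborel (radial_body g)"
proof -
  have "f (sgn x) = 0 \<or> g (sgn x) = 0" if "x \<noteq> 0" for x
    using disjoint_supports[of "sgn x"] that by (simp add: norm_sgn)
  then have "radial_body (\<lambda>u. f u + g u) = radial_body f \<union> radial_body g"
    "radial_body f \<inter> radial_body g = {}"
    by (force simp: radial_body_def)+
  then show ?thesis
    using plus_emeasure[of "radial_body f" lborel "radial_body g"]
      sets_radial_body[OF f] sets_radial_body[OF g] by simp
qed

lemma emeasure_radial_body_SUP:
  fixes U :: "nat \<Rightarrow> 'a::euclidean_space \<Rightarrow> ennreal"
  assumes "\<And>i. U i \<in> borel_measurable sphere_prob" and "incseq U"
  shows "emeasure lborel (radial_body (SUP i. U i)) = (SUP i. emeasure lborel (radial_body (U i)))"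
proof -
  have "radial_body (SUP i. U i) = (\<Union>i. radial_body (U i))"
    by (auto simp: radial_body_def less_SUP_iff)
  moreover have "incseq (\<lambda>i. radial_body (U i))"
    using assms(2) by (force simp: incseq_def le_fun_def radial_body_def intro: less_le_trans)
  ultimately show ?thesis
    using assms(1) by (simp add: SUP_emeasure_incseq sets_radial_body image_subset_iff)
qed

theorem emeasure_radial_body:
  fixes f :: "'a::euclidean_space \<Rightarrow> ennreal"
  assumes "f \<in> borel_measurable sphere_prob"
  shows "emeasure lborel (radial_body f)
    = emeasure lborel (cball 0 1 :: 'a set) * (\<integral>\<^sup>+u. f u ^ DIM('a) \<partial>sphere_prob)"
  using assms
proof (induction f rule: borel_measurable_induct)
  case (cong f g)
  then have "radial_body f = radial_body g" by (auto simp: radial_body_def norm_sgn)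
  moreover have "(\<integral>\<^sup>+u. f u ^ DIM('a) \<partial>sphere_prob) = (\<integral>\<^sup>+u. g u ^ DIM('a) \<partial>sphere_prob)"
    using cong by (intro nn_integral_cong) auto
  ultimately show ?case using cong by simp
next
  case (set A)
  have "indicator A u ^ DIM('a) = (indicator A u :: ennreal)" for u
    by (simp add: indicator_def)
  then show ?case using set emeasure_radial_body_indicator[OF set] by simp
next
  case (mult f c)
  then obtain r where "c = ennreal r" "0 \<le> r" by (cases c) auto
  then show ?case
    using mult by (simp add: emeasure_radial_body_cmult power_mult_distrib nn_integral_cmult
        ennreal_power mult.left_commute)
next
  case (add f g)
  \<comment> \<open>The rule only adds functions with disjoint supports, on which powers are additive.\<close>
  have "emeasure lborel (radial_body (\<lambda>u. g u + f u))
      = emeasure lborel (cball 0 1 :: 'a set) * (\<integral>\<^sup>+u. g u ^ DIM('a) + f u ^ DIM('a) \<partial>sphere_prob)"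
    using add.hyps add.IH
    by (subst emeasure_radial_body_add) (auto simp: nn_integral_add distrib_left)
  also have "(\<integral>\<^sup>+u. g u ^ DIM('a) + f u ^ DIM('a) \<partial>sphere_prob)
      = (\<integral>\<^sup>+u. (g u + f u) ^ DIM('a) \<partial>sphere_prob)"
  proof (rule nn_integral_cong)
    fix u :: 'a assume "u \<in> space sphere_prob"
    then show "g u ^ DIM('a) + f u ^ DIM('a) = (g u + f u) ^ DIM('a)"
      using add.hyps(5)[of u] by (auto simp: zero_power)
  qed
  finally show ?case .
next
  case (seq U)
  show ?case
    unfolding emeasure_radial_body_SUP[OF seq.hyps(1,3)] nn_integral_SUP_power[OF seq.hyps(1,3)]
    by (simp add: seq.IH SUP_mult_left_ennreal)
qed

lemma vol_le_expectation_power: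
  fixes f :: "'a::euclidean_space \<Rightarrow> real"
  assumes f: "continuous_on (sphere 0 1) f" "\<And>u. norm u = 1 \<Longrightarrow> 0 \<le> f u"
    and S: "S \<in> sets borel" "\<And>x. x \<in> S \<Longrightarrow> x \<noteq> 0 \<Longrightarrow> norm x < f (sgn x)"
  shows "vol S \<le> vol (cball 0 1 :: 'a set) * sphere_prob.expectation (\<lambda>u. f u ^ DIM('a))"
proof -
  let ?R = "radial_body (\<lambda>u. ennreal (f u))"
  let ?E = "sphere_prob.expectation (\<lambda>u. f u ^ DIM('a))"
  have meas: "(\<lambda>u. ennreal (f u)) \<in> borel_measurable sphere_prob"
    using borel_measurable_sphere_prob[OF f(1)] by simp
  then have R: "?R \<in> sets lborel" using sets_radial_body by simp
  have "S \<subseteq> ?R \<union> {0}" using S(2) by (auto simp: radial_body_def ennreal_less_iff)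
  then have "emeasure lborel S \<le> emeasure lborel (?R \<union> {0})"
    using R by (intro emeasure_mono) auto
  also have "\<dots> = emeasure lborel ?R"
    using R by (intro emeasure_Un_null_set) (auto intro: countable_imp_null_set_lborel)
  also have "\<dots> = emeasure lborel (cball 0 1 :: 'a set)
      * (\<integral>\<^sup>+u. ennreal (f u) ^ DIM('a) \<partial>sphere_prob)"
    by (rule emeasure_radial_body[OF meas])
  also have "(\<integral>\<^sup>+u. ennreal (f u) ^ DIM('a) \<partial>sphere_prob)
      = (\<integral>\<^sup>+u. ennreal (f u ^ DIM('a)) \<partial>sphere_prob)"
    using f(2) by (intro nn_integral_cong) (simp add: ennreal_power)
  also have "\<dots> = ennreal ?E"
    using f by (intro nn_integral_eq_integral integrable_sphere_prob continuous_intros) auto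
  finally have "enn2real (emeasure lborel S)
      \<le> enn2real (emeasure lborel (cball 0 1 :: 'a set) * ennreal ?E)"
    using emeasure_bounded_finite[OF bounded_cball[of "0 :: 'a" 1]]
    by (intro enn2real_mono) (simp_all add: ennreal_mult_less_top)
  moreover have "0 \<le> ?E" using f(2) by (intro Bochner_Integration.integral_nonneg) simp
  ultimately show ?thesis using S(1) by (simp add: measure_completion measure_def enn2real_mult)
qed

lemma emeasure_sphere_prob_open_pos:
  fixes U :: "'a::euclidean_space set"
  assumes "openin (top_of_set (sphere 0 1)) U" "U \<noteq> {}"
  shows "0 < emeasure sphere_prob U"
proof (rule ccontr)
  assume "\<not> 0 < emeasure sphere_prob U"
  obtain T where T: "open T" "U = sphere 0 1 \<inter> T" using assms(1) by (auto simp: openin_open)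
  obtain u where u: "u \<in> U" using assms(2) by blast
  let ?R = "radial_body (indicator U :: 'a \<Rightarrow> ennreal)"
  have U: "U \<in> sets sphere_prob" using T by (auto simp: sets_restrict_space)
  have "emeasure lborel ?R = 0"
    using \<open>\<not> 0 < emeasure sphere_prob U\<close> emeasure_radial_body_indicator[OF U] by simp
  then have "negligible ?R"
    using sets_radial_body[of "indicator U"] U
    by (simp add: negligible_iff_null_sets null_sets_completion_iff null_sets_def)
  moreover have "?R = (ball 0 1 - {0}) \<inter> sgn -` T"
    using T by (auto simp: radial_body_indicator norm_sgn)
  moreover have "open ((ball 0 1 - {0}) \<inter> sgn -` T)"
    using T by (intro continuous_open_preimage continuous_intros) auto
  moreover have "(1 / 2) *\<^sub>R u \<in> ?R"
    using u T by (auto simp: radial_body_indicator sgn_scaleR sgn_div_norm)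
  ultimately show False using open_not_negligible by (metis empty_iff)
qed

lemma AE_sphere_prob_eq_imp_eq:
  fixes f g :: "'a::euclidean_space \<Rightarrow> real"
  assumes f: "continuous_on (sphere 0 1) f" and g: "continuous_on (sphere 0 1) g"
    and ae: "AE u in sphere_prob. f u = g u" and u: "norm u = 1"
  shows "f u = g u"
proof (rule ccontr)
  assume "f u \<noteq> g u"
  define U where "U = sphere 0 1 \<inter> (\<lambda>u. f u - g u) -` (- {0})"
  have "openin (top_of_set (sphere 0 1)) U"
    unfolding U_def by (intro continuous_openin_preimage_gen continuous_intros f g)
  moreover have "U \<noteq> {}" using u \<open>f u \<noteq> g u\<close> by (auto simp: U_def)
  ultimately have "0 < emeasure sphere_prob U" by (rule emeasure_sphere_prob_open_pos)
  moreover have "AE u in sphere_prob. u \<notin> U" using ae by eventually_elim (simp add: U_def)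
  moreover have "{u \<in> space sphere_prob. u \<in> U} = U" by (auto simp: U_def)
  ultimately show False using AE_iff_measurable[of U sphere_prob "\<lambda>u. u \<notin> U"]
    by (metis emeasure_notin_sets less_irrefl)
qed

section \<open>Support functions\<close>

lemma inner_sgn_self: "x \<bullet> sgn x = norm x" for x :: "'a::real_inner"
  by (cases "x = 0") (simp_all add: sgn_div_norm dot_square_norm power2_eq_square)

lemma bdd_above_inner_image:
  fixes K :: "'a::euclidean_space set"
  assumes "bounded K"
  shows "bdd_above ((\<lambda>x. x \<bullet> u) ` K)"
  using bounded_linear_image[OF assms bounded_linear_inner_left] by (rule bounded_imp_bdd_above)

lemma inner_le_support_fun: "bounded K \<Longrightarrow> x \<in> K \<Longrightarrow> x \<bullet> u \<le> support_fun K u"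
  unfolding support_fun_def by (rule cSUP_upper[OF _ bdd_above_inner_image])

lemma support_fun_le: "K \<noteq> {} \<Longrightarrow> (\<And>x. x \<in> K \<Longrightarrow> x \<bullet> u \<le> c) \<Longrightarrow> support_fun K u \<le> c"
  unfolding support_fun_def by (rule cSUP_least)

lemma convex_on_support_fun:
  fixes K :: "'a::euclidean_space set"
  assumes "bounded K" "K \<noteq> {}"
  shows "convex_on UNIV (support_fun K)"
proof (rule convex_onI)
  fix t :: real and u v :: 'a
  assume t: "0 < t" "t < 1"
  show "support_fun K ((1 - t) *\<^sub>R u + t *\<^sub>R v) \<le> (1 - t) * support_fun K u + t * support_fun K v"
  proof (rule support_fun_le[OF assms(2)])
    fix x assume "x \<in> K"
    then have "(1 - t) * (x \<bullet> u) \<le> (1 - t) * support_fun K u" "t * (x \<bullet> v) \<le> t * support_fun K v"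
      using t assms(1) by (simp_all add: inner_le_support_fun)
    then show "x \<bullet> ((1 - t) *\<^sub>R u + t *\<^sub>R v) \<le> (1 - t) * support_fun K u + t * support_fun K v"
      by (simp add: inner_add_right)
  qed
qed simp

lemma continuous_on_support_fun:
  fixes K :: "'a::euclidean_space set"
  assumes "bounded K" "K \<noteq> {}"
  shows "continuous_on S (support_fun K)"
  using convex_on_continuous[OF open_UNIV convex_on_support_fun[OF assms]]
  by (rule continuous_on_subset) simp

lemma support_fun_mono:
  assumes "A \<subseteq> B" "A \<noteq> {}" "bounded B"
  shows "support_fun A u \<le> support_fun B u"
  using assms by (intro support_fun_le inner_le_support_fun) auto

lemma support_fun_cball:
  fixes u :: "'a::euclidean_space"
  assumes "0 \<le> r"
  shows "support_fun (cball 0 r) u = r * norm u"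
proof (rule antisym)
  show "support_fun (cball 0 r) u \<le> r * norm u"
  proof (rule support_fun_le)
    fix x :: 'a assume "x \<in> cball 0 r"
    then show "x \<bullet> u \<le> r * norm u"
      using norm_cauchy_schwarz[of x u] mult_right_mono[of "norm x" r "norm u"] by simp
  qed (use assms in simp)
  have "r * norm u = (r *\<^sub>R sgn u) \<bullet> u"
    using inner_sgn_self[of u] by (simp add: inner_commute)
  also have "\<dots> \<le> support_fun (cball 0 r) u"
    using assms by (intro inner_le_support_fun) (auto simp: norm_sgn)
  finally show "r * norm u \<le> support_fun (cball 0 r) u" .
qed

lemma support_fun_pos:
  fixes K :: "'a::euclidean_space set"
  assumes "bounded K" "0 \<in> interior K" "u \<noteq> 0"
  shows "0 < support_fun K u"
proof -
  obtain r where r: "0 < r" "cball 0 r \<subseteq> K" using assms(2) by (auto simp: mem_interior_cball)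
  then have "0 < support_fun (cball 0 r) u" using assms(3) by (simp add: support_fun_cball)
  also have "\<dots> \<le> support_fun K u" using r assms(1) by (intro support_fun_mono) auto
  finally show ?thesis .
qed

lemma support_fun_unit_pos: "bounded K \<Longrightarrow> 0 \<in> interior K \<Longrightarrow> norm u = 1 \<Longrightarrow> 0 < support_fun K u"
  by (rule support_fun_pos) auto

lemma AE_sphere_prob_support_fun_pos:
  assumes "bounded K" "0 \<in> interior K"
  shows "AE u in sphere_prob. support_fun K u \<in> {0<..}"
  using support_fun_unit_pos[OF assms] by (intro AE_I2) auto

lemma subset_if_support_fun_le:
  fixes K L :: "'a::euclidean_space set"
  assumes "bounded K" and L: "closed L" "convex L" "L \<noteq> {}"
    and le: "\<And>u. norm u = 1 \<Longrightarrow> support_fun K u \<le> support_fun L u"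
  shows "K \<subseteq> L"
proof (rule subsetI, rule ccontr)
  fix x assume x: "x \<in> K" "x \<notin> L"
  obtain a b where ab: "a \<bullet> x < b" "\<forall>y\<in>L. b < a \<bullet> y"
    using separating_hyperplane_closed_point[OF L(2,1) x(2)] by blast
  have "a \<noteq> 0" using ab L(3) by auto
  have inner: "y \<bullet> sgn a = (a \<bullet> y) / norm a" for y
    by (simp add: sgn_div_norm inner_commute divide_inverse)
  have "support_fun L (- sgn a) \<le> - (b / norm a)"
  proof (rule support_fun_le[OF L(3)])
    fix y assume "y \<in> L"
    then have "b \<le> a \<bullet> y" using ab(2) by (simp add: less_imp_le)
    then show "y \<bullet> - sgn a \<le> - (b / norm a)" by (simp add: inner divide_right_mono)
  qed
  also have "\<dots> < x \<bullet> - sgn a" using ab(1) \<open>a \<noteq> 0\<close> by (simp add: inner divide_strict_right_mono)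
  also have "\<dots> \<le> support_fun K (- sgn a)" using assms(1) x(1) by (rule inner_le_support_fun)
  finally show False using le[of "- sgn a"] \<open>a \<noteq> 0\<close> by (simp add: norm_sgn)
qed

lemma eq_if_support_fun_eq:
  fixes K L :: "'a::euclidean_space set"
  assumes "compact K" "convex K" "K \<noteq> {}" "compact L" "convex L" "L \<noteq> {}"
    and "\<And>u. norm u = 1 \<Longrightarrow> support_fun K u = support_fun L u"
  shows "K = L"
  using assms by (intro antisym subset_if_support_fun_le)
    (simp_all add: compact_imp_bounded compact_imp_closed)

section \<open>Urysohn's inequality\<close>

lemma (in prob_space) has_real_derivative_expectation_power:
  assumes int: "\<And>k. k \<le> n \<Longrightarrow> integrable M (\<lambda>x. f x ^ k)"
  shows "((\<lambda>t. expectation (\<lambda>x. (1 + t * f x) ^ n))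
    has_real_derivative real n * expectation f) (at 0)"
proof -
  define c where "c k = real (n choose k) * expectation (\<lambda>x. f x ^ k)" for k
  have expansion: "expectation (\<lambda>x. (1 + t * f x) ^ n) = (\<Sum>k\<le>n. c k * t ^ k)" for t
  proof -
    have "(1 + t * f x) ^ n = (\<Sum>k\<le>n. (real (n choose k) * t ^ k) * f x ^ k)" for x
      using binomial_ring[of "t * f x" 1 n] by (simp add: power_mult_distrib add.commute mult.assoc)
    then show ?thesis
      using int by (simp add: Bochner_Integration.integral_sum c_def mult.commute mult.left_commute)
  qed
  have "((\<lambda>t. \<Sum>k\<le>n. c k * t ^ k) has_real_derivative (\<Sum>k\<le>n. c k * (real k * 0 ^ (k - 1)))) (at 0)"
    by (auto intro!: derivative_eq_intros sum.cong)
  moreover have "(\<Sum>k\<le>n. c k * (real k * 0 ^ (k - 1))) = (\<Sum>k\<le>n. if k = 1 then c 1 else 0)"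
    by (intro sum.cong) (auto simp: power_0_left)
  moreover have "\<dots> = n * expectation f" by (auto simp: c_def)
  ultimately show ?thesis by (simp add: expansion)
qed

lemma has_real_derivative_mono_at_right:
  fixes f g :: "real \<Rightarrow> real"
  assumes f: "(f has_real_derivative f') (at x)" and g: "(g has_real_derivative g') (at x)"
    and le: "\<And>t. x < t \<Longrightarrow> f t \<le> g t" and "f x = g x"
  shows "f' \<le> g'"
proof (rule ccontr)
  assume "\<not> f' \<le> g'"
  then obtain d where "0 < d" "\<forall>h>0. h < d \<longrightarrow> f x - g x < f (x + h) - g (x + h)"
    using has_real_derivative_pos_inc_right[OF DERIV_diff[OF f g]] by auto
  then have "f x - g x < f (x + d / 2) - g (x + d / 2)" by simp
  then show False using le[of "x + d / 2"] \<open>0 < d\<close> \<open>f x = g x\<close> by simp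
qed

lemma vol_unit_ball_plus_le:
  fixes K :: "'a::euclidean_space set"
  assumes K: "bounded K" "0 \<in> interior K" and t: "0 < t"
  shows "vol (ball 0 1 + (*\<^sub>R) t ` interior K)
    \<le> vol (cball 0 1 :: 'a set) * sphere_prob.expectation (\<lambda>u. (1 + t * support_fun K u) ^ DIM('a))"
proof (rule vol_le_expectation_power)
  have "K \<noteq> {}" using K interior_subset by blast
  then show "continuous_on (sphere 0 1) (\<lambda>u. 1 + t * support_fun K u)"
    by (intro continuous_intros continuous_on_support_fun K)
  show "0 \<le> 1 + t * support_fun K u" if "norm u = 1" for u
    using support_fun_unit_pos[OF K that] t by (simp add: less_imp_le)
  show "ball 0 1 + (*\<^sub>R) t ` interior K \<in> sets borel"
    by (intro borel_open open_set_plus open_ball)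
next
  fix x assume "x \<in> ball 0 1 + (*\<^sub>R) t ` interior K" "x \<noteq> 0"
  then obtain y k where x: "x = y + t *\<^sub>R k" "norm y < 1" "k \<in> K"
    using interior_subset by (fastforce elim!: set_plus_elim)
  have "norm x = x \<bullet> sgn x" by (simp only: inner_sgn_self)
  also have "\<dots> = y \<bullet> sgn x + t * (k \<bullet> sgn x)" by (simp add: x(1) inner_add_left)
  also have "\<dots> < 1 + t * support_fun K (sgn x)"
  proof (intro add_less_le_mono mult_left_mono)
    have "y \<bullet> sgn x \<le> norm y * norm (sgn x)" by (rule norm_cauchy_schwarz)
    then show "y \<bullet> sgn x < 1" using x \<open>x \<noteq> 0\<close> by (simp add: norm_sgn)
    show "k \<bullet> sgn x \<le> support_fun K (sgn x)" using K x by (intro inner_le_support_fun)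
  qed (use t in simp)
  finally show "norm x < 1 + t * support_fun K (sgn x)" .
qed

theorem urysohn:
  fixes K :: "'a::euclidean_space set"
  assumes K: "bounded K" "convex K" "0 \<in> interior K"
  shows "vrad K \<le> sphere_prob.expectation (support_fun K)"
proof -
  let ?n = "DIM('a)" and ?\<omega> = "vol (cball 0 1 :: 'a set)"
  let ?F = "\<lambda>t. sphere_prob.expectation (\<lambda>u. (1 + t * support_fun K u) ^ ?n)"
  have ne: "K \<noteq> {}" using K interior_subset by blast
  have bound: "(1 + t * vrad K) ^ ?n \<le> ?F t" if "0 < t" for t
  proof -
    let ?T = "(*\<^sub>R) t ` interior K"
    have "1 + t * vrad K = vrad (ball 0 1 :: 'a set) + vrad ?T"
      using that K by (simp add: vrad_ball vrad_scaleR_image vrad_interior_convex)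
    also have "\<dots> \<le> vrad (ball 0 1 + ?T)"
      using that K by (intro brunn_minkowski)
        (auto intro!: open_scaling bounded_scaling bounded_interior)
    finally have "?\<omega> * (1 + t * vrad K) ^ ?n \<le> ?\<omega> * vrad (ball 0 1 + ?T) ^ ?n"
      using that by (intro mult_left_mono power_mono) (simp_all add: vrad_nonneg)
    also have "\<dots> = vol (ball 0 1 + ?T)" by (rule vol_eq_vrad_power[symmetric])
    also have "\<dots> \<le> ?\<omega> * ?F t" using that K by (intro vol_unit_ball_plus_le)
    finally show ?thesis using vol_unit_cball_pos[where 'a='a] by simp
  qed
  have "((\<lambda>t. (1 + t * vrad K) ^ ?n) has_real_derivative ?n * vrad K) (at 0)"
    by (auto intro!: derivative_eq_intros)
  moreover have "(?F has_real_derivative ?n * sphere_prob.expectation (support_fun K)) (at 0)"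
    by (intro sphere_prob.has_real_derivative_expectation_power integrable_sphere_prob
        continuous_intros continuous_on_support_fun K ne)
  ultimately have "?n * vrad K \<le> ?n * sphere_prob.expectation (support_fun K)"
    using bound by (rule has_real_derivative_mono_at_right) simp_all
  then show ?thesis by simp
qed

section \<open>The equality case of Jensen's inequality\<close>

lemma strictly_convex_onD:
  "\<lbrakk>strictly_convex_on S f; x \<in> S; y \<in> S; x \<noteq> y; 0 < u; 0 < v; u + v = 1\<rbrakk>
    \<Longrightarrow> f (u *\<^sub>R x + v *\<^sub>R y) < u * f x + v * f y"
  by (simp add: strictly_convex_on_def)

lemma strictly_convex_on_imp_convex_on:
  assumes "strictly_convex_on S f"
  shows "convex_on S f"
proof (rule convex_onI)
  fix t :: real and x y
  assume "0 < t" "t < 1" "x \<in> S" "y \<in> S"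
  then show "f ((1 - t) *\<^sub>R x + t *\<^sub>R y) \<le> (1 - t) * f x + t * f y"
    using strictly_convex_onD[OF assms, of x y "1 - t" t]
    by (cases "x = y") (auto simp: algebra_simps)
qed (use assms in \<open>simp add: strictly_convex_on_def\<close>)

lemma strictly_convex_on_supporting_line:
  fixes \<phi> :: "real \<Rightarrow> real"
  assumes \<phi>: "strictly_convex_on I \<phi>" and m: "m \<in> interior I"
  obtains c where "\<And>x. x \<in> I \<Longrightarrow> x \<noteq> m \<Longrightarrow> \<phi> m + c * (x - m) < \<phi> x"
proof -
  define c where "c = Inf ((\<lambda>t. (\<phi> m - \<phi> t) / (m - t)) ` ({m<..} \<inter> I))"
  have line: "\<phi> m + c * (x - m) \<le> \<phi> x" if "x \<in> I" for x
    unfolding c_def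
    by (rule convex_le_Inf_differential[OF strictly_convex_on_imp_convex_on[OF \<phi>] m that])
  show thesis
  proof (rule that)
    fix x assume x: "x \<in> I" "x \<noteq> m"
    have "m \<in> I" using m interior_subset by blast
    then have mid: "\<phi> ((1/2) *\<^sub>R x + (1/2) *\<^sub>R m) < 1/2 * \<phi> x + 1/2 * \<phi> m"
      using x by (intro strictly_convex_onD[OF \<phi>]) auto
    have "(1/2) *\<^sub>R x + (1/2) *\<^sub>R m \<in> I"
      using \<phi> x \<open>m \<in> I\<close> unfolding strictly_convex_on_def by (intro convexD) auto
    from line[OF this] mid show "\<phi> m + c * (x - m) < \<phi> x" by (simp add: algebra_simps)
  qed
qed

lemma (in prob_space) jensen_eq_imp_AE_const:
  fixes \<phi> :: "real \<Rightarrow> real"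
  assumes \<phi>: "strictly_convex_on I \<phi>" and X: "integrable M X" "AE x in M. X x \<in> I"
    and mean: "expectation X \<in> interior I" and int: "integrable M (\<lambda>x. \<phi> (X x))"
    and eq: "expectation (\<lambda>x. \<phi> (X x)) = \<phi> (expectation X)"
  shows "AE x in M. X x = expectation X"
proof -
  let ?m = "expectation X"
  obtain c where c: "\<And>x. x \<in> I \<Longrightarrow> x \<noteq> ?m \<Longrightarrow> \<phi> ?m + c * (x - ?m) < \<phi> x"
    using strictly_convex_on_supporting_line[OF \<phi> mean] by blast
  define gap where "gap x = \<phi> (X x) - (\<phi> ?m + c * (X x - ?m))" for x
  have gap: "0 \<le> gap x \<and> (gap x = 0 \<longrightarrow> X x = ?m)" if "X x \<in> I" for x
    using c[OF that] by (cases "X x = ?m") (auto simp: gap_def)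
  have "integrable M gap" using X(1) int by (simp add: gap_def[abs_def])
  moreover have "AE x in M. 0 \<le> gap x" using X(2) by eventually_elim (simp add: gap)
  moreover have "expectation gap = 0"
    using X(1) int eq by (simp add: gap_def[abs_def] prob_space)
  ultimately have "AE x in M. gap x = 0" by (simp add: integral_nonneg_eq_0_iff_AE)
  with X(2) show ?thesis by eventually_elim (use gap in blast)
qed

section \<open>The Orlicz--Urysohn inequality\<close>

lemma orlicz_mean_width_cball:
  assumes "0 \<le> r"
  shows "orlicz_mean_width \<phi> (cball 0 r :: 'a::euclidean_space set) = \<phi> r"
proof -
  have eq: "\<phi> (support_fun (cball 0 r) u) = \<phi> r" if "u \<in> sphere 0 1" for u :: 'a
    using assms that by (simp add: support_fun_cball)
  then have "continuous_on (sphere 0 1) (\<lambda>u::'a. \<phi> (support_fun (cball 0 r) u))"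
    by (subst continuous_on_cong[OF refl eq]) auto
  then have "orlicz_mean_width \<phi> (cball 0 r :: 'a set)
      = sphere_prob.expectation (\<lambda>u::'a. \<phi> (support_fun (cball 0 r) u))"
    by (rule orlicz_mean_width_eq_expectation)
  also have "\<dots> = sphere_prob.expectation (\<lambda>u::'a. \<phi> r)"
    using eq by (intro Bochner_Integration.integral_cong) auto
  finally show ?thesis by simp
qed

lemma vrad_ball_eq_cball: "vrad_ball K = cball 0 (vrad K)"
  by (simp add: vrad_ball_def scaleR_image_unit_cball vrad_nonneg)

lemma origin_symmetric_ball_iff: "origin_symmetric_ball K \<longleftrightarrow> (\<exists>r>0. K = cball 0 r)"
  unfolding origin_symmetric_ball_def by (metis scaleR_image_unit_cball less_imp_le)

lemma vrad_pos_if_interior: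
  fixes K :: "'a::euclidean_space set"
  assumes "bounded K" "convex K" "interior K \<noteq> {}"
  shows "0 < vrad K"
  using vol_open_pos[of "interior K"] assms
  by (simp add: vrad_pos_iff vol_interior_convex bounded_interior)

lemma continuous_on_comp_support_fun:
  fixes K :: "'a::euclidean_space set"
  assumes K: "bounded K" "0 \<in> interior K" and \<phi>: "convex_on {0<..} \<phi>"
  shows "continuous_on (sphere 0 1) (\<lambda>u. \<phi> (support_fun K u))"
proof (rule continuous_on_compose2[OF convex_on_continuous[OF _ \<phi>]])
  show "continuous_on (sphere 0 1) (support_fun K)"
    using K interior_subset by (intro continuous_on_support_fun) auto
qed (use support_fun_unit_pos[OF K] in auto)

lemma jensen_orlicz_mean_width:
  fixes K :: "'a::euclidean_space set"
  assumes K: "bounded K" "0 \<in> interior K" and \<phi>: "convex_on {0<..} \<phi>"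
  shows "\<phi> (sphere_prob.expectation (support_fun K)) \<le> orlicz_mean_width \<phi> K"
proof -
  have "K \<noteq> {}" using K interior_subset by blast
  then show ?thesis
    using continuous_on_comp_support_fun[OF K \<phi>]
    by (subst orlicz_mean_width_eq_expectation)
      (auto intro!: sphere_prob.jensens_inequality[where I = "{0<..}"] integrable_sphere_prob
        AE_sphere_prob_support_fun_pos continuous_on_support_fun K \<phi>)
qed

lemma eq_cball_if_orlicz_mean_width_eq:
  fixes K :: "'a::euclidean_space set"
  assumes K: "compact K" "convex K" "0 \<in> interior K" and \<phi>: "strictly_convex_on {0<..} \<phi>"
    and m: "m = sphere_prob.expectation (support_fun K)" "0 < m"
    and eq: "orlicz_mean_width \<phi> K = \<phi> m"
  shows "K = cball 0 m"
proof (rule eq_if_support_fun_eq)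
  have bounded: "bounded K" using K(1) by (rule compact_imp_bounded)
  show "K \<noteq> {}" using K interior_subset by blast
  then have h: "continuous_on (sphere 0 1) (support_fun K)"
    by (rule continuous_on_support_fun[OF bounded])
  have \<phi>h: "continuous_on (sphere 0 1) (\<lambda>u. \<phi> (support_fun K u))"
    by (intro continuous_on_comp_support_fun bounded K strictly_convex_on_imp_convex_on \<phi>)
  have "AE u in sphere_prob. support_fun K u = m"
    using m eq unfolding orlicz_mean_width_eq_expectation[OF \<phi>h] m(1)
    by (intro sphere_prob.jensen_eq_imp_AE_const[OF \<phi>] AE_sphere_prob_support_fun_pos
        integrable_sphere_prob bounded K h \<phi>h)
      (auto simp: interior_open)
  then show "support_fun K u = support_fun (cball 0 m) u" if "norm u = 1" for u
    using AE_sphere_prob_eq_imp_eq[OF h continuous_on_const _ that] m that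
    by (simp add: support_fun_cball)
qed (use K m in auto)

theorem theorem3p3:
  fixes K :: "'a::euclidean_space set" and \<phi> :: "real \<Rightarrow> real"
  assumes "convex_body K"
    and "0 \<in> interior K"
    and "\<forall>t>0. \<phi> t > 0"
    and "mono_on {0<..} \<phi>"
    and "convex_on {0<..} \<phi>"
  shows "orlicz_mean_width \<phi> K \<ge> orlicz_mean_width \<phi> (vrad_ball K) \<and>
    (strictly_convex_on {0<..} \<phi> \<longrightarrow>
      (orlicz_mean_width \<phi> K = orlicz_mean_width \<phi> (vrad_ball K) \<longleftrightarrow> origin_symmetric_ball K))"
proof -
  define m where "m = sphere_prob.expectation (support_fun K)"
  have K: "compact K" "bounded K" "convex K"
    using assms(1) by (auto simp: convex_body_def compact_imp_bounded)
  have ball: "orlicz_mean_width \<phi> (vrad_ball K) = \<phi> (vrad K)"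
    by (simp add: vrad_ball_eq_cball orlicz_mean_width_cball vrad_nonneg)
  have "0 < vrad K" "vrad K \<le> m"
    using vrad_pos_if_interior[of K] urysohn[of K] K assms(2) by (auto simp: m_def)
  then have "0 < m" and mono: "\<phi> (vrad K) \<le> \<phi> m" using mono_onD[OF assms(4)] by auto
  have jensen: "\<phi> m \<le> orlicz_mean_width \<phi> K"
    unfolding m_def by (rule jensen_orlicz_mean_width[OF K(2) assms(2,5)])
  have "K = cball 0 m"
    if strict: "strictly_convex_on {0<..} \<phi>"
      and eq: "orlicz_mean_width \<phi> K = orlicz_mean_width \<phi> (vrad_ball K)"
    using eq_cball_if_orlicz_mean_width_eq[OF K(1,3) assms(2) strict m_def \<open>0 < m\<close>]
      eq ball mono jensen by linarith
  then have "origin_symmetric_ball K"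
    if "strictly_convex_on {0<..} \<phi>" "orlicz_mean_width \<phi> K = orlicz_mean_width \<phi> (vrad_ball K)"
    using that \<open>0 < m\<close> by (auto simp: origin_symmetric_ball_iff)
  moreover have "vrad_ball K = K" if "origin_symmetric_ball K"
    using that by (auto simp: origin_symmetric_ball_iff vrad_ball_eq_cball vrad_cball)
  ultimately show ?thesis using ball mono jensen by auto
qed

end
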